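(* Let $G$ be a finite abelian group of order $n\ge 2$, and let $l$ be the order of its subgroup of elements of order at most $2$. Then for every integer $h$ with $(n+l)/2-1\le h\le n-2$ we have $C_h(G)=h+1$.
   Context: $G$ is written additively. For $A\subseteq G$ and a positive integer $h$, $h\hat{\;}A$ denotes the set of all sums of $h$ pairwise distinct elements of $A$. $C_h(G)=\max\{|A| : A\subseteq G,\ h\hat{\;}A\neq G\}$. *)

theory Defs
  imports "HOL-Algebra.Algebra"
begin

(* HOL-Algebra writes abelian groups multiplicatively, so the sum of the elements of a
   finite set B is finprod G (\<lambda>x. x) B. A sum of h pairwise distinct elements of A is the
   sum over an h-element subset of A; "finite B" only matters for h = 0, as card is 0 on
   infinite sets. *)
definition restricted_sumset ::
    "('a, 'b) monoid_scheme \<Rightarrow> nat \<Rightarrow> 'a set \<Rightarrow> 'a set"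
  where "restricted_sumset G h A =
    {finprod G (\<lambda>x. x) B | B. B \<subseteq> A \<and> finite B \<and> card B = h}"

(* For finite G and h > 0 the maximum is over a finite set that is nonempty, since A = {}
   qualifies. *)
definition C_number :: "('a, 'b) monoid_scheme \<Rightarrow> nat \<Rightarrow> nat"
  where "C_number G h =
    Max {card A | A. A \<subseteq> carrier G \<and> restricted_sumset G h A \<noteq> carrier G}"

(* group.ord is 0 on elements of infinite order; in a finite group every order is positive. *)
definition order_le_2_subgroup :: "('a, 'b) monoid_scheme \<Rightarrow> 'a set"
  where "order_le_2_subgroup G = {x \<in> carrier G. group.ord G x \<le> 2}"

end

theory Submission
  imports Defs
begin

text \<open>
  If \<open>A\<close> has \<open>h + k\<close> elements, passing to complements turns sums of \<open>h\<close> distinct elements into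
  sums of \<open>k\<close> distinct elements, up to a reflection of \<open>G\<close>. With \<open>k = 1\<close> this shows that a set of
  size \<open>h + 1 < n\<close> has a proper sumset. With \<open>k = 2\<close> it reduces the sets of size \<open>h + 2\<close> to pairs:
  \<open>A\<close> and \<open>g - A\<close> meet in at least \<open>2 |A| - n > l\<close> points, while \<open>x + x = g\<close> has at most \<open>l\<close>
  solutions, so \<open>g\<close> is a sum of two distinct elements of \<open>A\<close>.
\<close>

lemma restricted_sumset_mono:
  "A \<subseteq> A' \<Longrightarrow> restricted_sumset G h A \<subseteq> restricted_sumset G h A'"
  by (auto simp: restricted_sumset_def)

context comm_group
begin

lemma restricted_sumset_closed:
  "A \<subseteq> carrier G \<Longrightarrow> restricted_sumset G h A \<subseteq> carrier G"
  by (auto simp: restricted_sumset_def intro!: finprod_closed)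

lemma restricted_sumset_1:
  assumes "A \<subseteq> carrier G"
  shows "restricted_sumset G 1 A = A"
proof -
  have "restricted_sumset G 1 A = {finprod G (\<lambda>x. x) {a} | a. a \<in> A}"
    unfolding restricted_sumset_def by (auto simp: card_1_singleton_iff)
  also have "\<dots> = {a | a. a \<in> A}"
    using assms by (intro Collect_cong ex_cong1) (auto simp: subset_iff)
  finally show ?thesis by simp
qed

lemma mult_mem_restricted_sumset_2:
  assumes "A \<subseteq> carrier G" "x \<in> A" "y \<in> A" "x \<noteq> y"
  shows "x \<otimes> y \<in> restricted_sumset G 2 A"
proof -
  have "finprod G (\<lambda>x. x) {x, y} = x \<otimes> y"
    using assms by (subst finprod_insert) (auto simp: subset_iff)
  then show ?thesis
    unfolding restricted_sumset_def using assms by (auto intro!: exI[of _ "{x, y}"])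
qed

text \<open>The sums over \<open>B\<close> and over \<open>A - B\<close> add up to the sum over
  \<open>A\<close>, and \<open>B \<mapsto> A - B\<close> exchanges the subsets of size
  \<open>h\<close> with those of size \<open>k\<close>. This trades a large \<open>h\<close> for
  \<open>k = 1\<close> or \<open>k = 2\<close>.\<close>

lemma restricted_sumset_complement:
  assumes A: "A \<subseteq> carrier G" "finite A" "card A = h + k"
  shows "restricted_sumset G h A =
    (\<lambda>s. finprod G (\<lambda>x. x) A \<otimes> inv s) ` restricted_sumset G k A"
proof -
  have finprod_diff: "finprod G (\<lambda>x. x) B = finprod G (\<lambda>x. x) A \<otimes> inv (finprod G (\<lambda>x. x) (A - B))"
    if "B \<subseteq> A" for B
  proof -
    have "finprod G (\<lambda>x. x) (B \<union> (A - B)) = finprod G (\<lambda>x. x) B \<otimes> finprod G (\<lambda>x. x) (A - B)"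
      using that A by (intro finprod_Un_disjoint) (auto intro: finite_subset)
    moreover have "B \<union> (A - B) = A" using that by auto
    moreover have "finprod G (\<lambda>x. x) B \<in> carrier G" "finprod G (\<lambda>x. x) (A - B) \<in> carrier G"
      using that A by (auto intro!: finprod_closed)
    ultimately show ?thesis by (simp add: m_assoc)
  qed
  show ?thesis
  proof (intro equalityI subsetI)
    fix s assume "s \<in> restricted_sumset G h A"
    then obtain B where B: "B \<subseteq> A" "finite B" "card B = h" "s = finprod G (\<lambda>x. x) B"
      by (auto simp: restricted_sumset_def)
    have "finprod G (\<lambda>x. x) (A - B) \<in> restricted_sumset G k A"
      unfolding restricted_sumset_def using A B by (auto simp: card_Diff_subset intro!: exI[of _ "A - B"])
    with B finprod_diff show "s \<in> (\<lambda>s. finprod G (\<lambda>x. x) A \<otimes> inv s) ` restricted_sumset G k A"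
      by blast
  next
    fix s assume "s \<in> (\<lambda>s. finprod G (\<lambda>x. x) A \<otimes> inv s) ` restricted_sumset G k A"
    then obtain B where B: "B \<subseteq> A" "finite B" "card B = k"
        "s = finprod G (\<lambda>x. x) A \<otimes> inv (finprod G (\<lambda>x. x) B)"
      by (auto simp: restricted_sumset_def)
    \<comment> \<open>Since \<open>A - (A - B) = B\<close>, the same identity applied to
      \<open>A - B\<close> gives the reverse inclusion.\<close>
    have "s = finprod G (\<lambda>x. x) (A - B)"
      using finprod_diff[of "A - B"] B by (simp add: double_diff)
    then show "s \<in> restricted_sumset G h A"
      unfolding restricted_sumset_def using A B by (auto simp: card_Diff_subset intro!: exI[of _ "A - B"])
  qed
qed

text \<open>Two solutions of \<open>x \<otimes> x = g\<close> differ by an element of order at most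
  2, so translating by a fixed solution \<open>c\<close> embeds the solution set into that
  subgroup.\<close>

lemma card_square_roots_le:
  assumes fin: "finite (carrier G)"
  shows "card {x \<in> carrier G. x \<otimes> x = g} \<le> card (order_le_2_subgroup G)"
proof (cases "{x \<in> carrier G. x \<otimes> x = g} = {}")
  case True
  then show ?thesis by (metis card.empty le0)
next
  case False
  then obtain c where c: "c \<in> carrier G" "c \<otimes> c = g" by auto
  show ?thesis
  proof (rule card_inj_on_le)
    show "inj_on (\<lambda>x. x \<otimes> inv c) {x \<in> carrier G. x \<otimes> x = g}"
      using c by (auto intro!: inj_onI)
    show "finite (order_le_2_subgroup G)"
      using fin by (auto simp: order_le_2_subgroup_def)
    show "(\<lambda>x. x \<otimes> inv c) ` {x \<in> carrier G. x \<otimes> x = g} \<subseteq> order_le_2_subgroup G"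
    proof clarify
      fix x assume x: "x \<in> carrier G" "g = x \<otimes> x"
      \<comment> \<open>Commutativity separates the squares of \<open>x\<close> and
        \<open>c\<close>, both equal to \<open>g\<close>.\<close>
      have "(x \<otimes> inv c) [^] (2::nat) = (x \<otimes> x) \<otimes> inv (c \<otimes> c)"
        using x c(1) by (simp add: numeral_2_eq_2 inv_mult m_ac)
      also have "\<dots> = \<one>" using x c by (metis m_closed r_inv)
      finally have "ord (x \<otimes> inv c) dvd 2"
        using x c by (subst (asm) pow_eq_id) auto
      then show "x \<otimes> inv c \<in> order_le_2_subgroup G"
        using x c by (auto simp: order_le_2_subgroup_def dest: dvd_imp_le)
    qed
  qed
qed

lemma restricted_sumset_2_eq_carrier:
  assumes fin: "finite (carrier G)" and A: "A \<subseteq> carrier G"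
    and large: "order G + card (order_le_2_subgroup G) < 2 * card A"
  shows "restricted_sumset G 2 A = carrier G"
proof (intro equalityI subsetI)
  fix g assume g: "g \<in> carrier G"
  \<comment> \<open>In additive terms \<open>R\<close> is g - A, so a point of
    \<open>A \<inter> R\<close> is an element of \<open>A\<close> whose partner with sum g also lies
    in \<open>A\<close>.\<close>
  define R where "R = (\<lambda>x. g \<otimes> inv x) ` A"
  have finA: "finite A" using A fin by (rule finite_subset)
  have "inj_on (\<lambda>x. g \<otimes> inv x) A"
    using A g by (auto intro!: inj_onI simp: subset_iff)
  then have "card R = card A" by (simp add: R_def card_image)
  moreover have "card (A \<union> R) \<le> order G"
    unfolding order_def using A g fin by (intro card_mono) (auto simp: R_def)
  moreover have "card A + card R = card (A \<union> R) + card (A \<inter> R)"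
    using finA by (intro card_Un_Int) (auto simp: R_def)
  ultimately have "card (order_le_2_subgroup G) < card (A \<inter> R)"
    using large by linarith
  then have "card {x \<in> carrier G. x \<otimes> x = g} < card (A \<inter> R)"
    using card_square_roots_le[OF fin, of g] by linarith
  then have "\<not> A \<inter> R \<subseteq> {x \<in> carrier G. x \<otimes> x = g}"
    using card_mono[of "{x \<in> carrier G. x \<otimes> x = g}" "A \<inter> R"] fin by auto
  \<comment> \<open>The partner of \<open>x\<close> is \<open>y\<close>; as
    \<open>x \<otimes> x \<noteq> g\<close>, the two are distinct.\<close>
  then obtain x y where xy: "x \<in> A" "y \<in> A" "x = g \<otimes> inv y" "x \<otimes> x \<noteq> g"
    using A by (auto simp: R_def)
  then have "x \<otimes> y = g"
    using A g by (auto simp: m_assoc subset_iff)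
  then show "g \<in> restricted_sumset G 2 A"
    using mult_mem_restricted_sumset_2[OF A, of x y] xy(1,2,4) by metis
qed (use restricted_sumset_closed[OF A] in blast)

text \<open>Omitting one element at a time, each sum is determined by the omitted element of
  \<open>A\<close>. This serves the lower bound for \<open>C_number\<close>.\<close>

lemma card_restricted_sumset_Suc:
  assumes "A \<subseteq> carrier G" "finite A" "card A = h + 1"
  shows "card (restricted_sumset G h A) \<le> h + 1"
  unfolding restricted_sumset_complement[OF assms] restricted_sumset_1[OF assms(1)]
  using card_image_le[OF assms(2)] assms(3) by metis

lemma restricted_sumset_eq_carrier:
  assumes fin: "finite (carrier G)" and A: "A \<subseteq> carrier G" "h + 2 \<le> card A"
    and large: "order G + card (order_le_2_subgroup G) < 2 * (h + 2)"
  shows "restricted_sumset G h A = carrier G"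
proof -
  \<comment> \<open>Cutting down to exactly \<open>h + 2\<close> elements makes the complements
    pairs; monotonicity returns to \<open>A\<close>.\<close>
  obtain A' where A': "A' \<subseteq> A" "finite A'" "card A' = h + 2"
    using A(2) by (rule obtain_subset_with_card_n)
  define s where "s = finprod G (\<lambda>x. x) A'"
  have sub: "A' \<subseteq> carrier G" using A' A by auto
  then have s: "s \<in> carrier G" by (auto simp: s_def intro!: finprod_closed)
  have "restricted_sumset G h A' = (\<lambda>x. s \<otimes> inv x) ` carrier G"
    using restricted_sumset_complement[OF sub A'(2,3)]
      restricted_sumset_2_eq_carrier[OF fin sub] A'(3) large by (simp add: s_def)
  \<comment> \<open>The reflection in \<open>s\<close> is an involution, so it maps the carrier onto
    itself.\<close>
  moreover have "g = s \<otimes> inv (s \<otimes> inv g)" if "g \<in> carrier G" for g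
    using that s by (simp add: inv_mult m_assoc[symmetric])
  ultimately have "carrier G \<subseteq> restricted_sumset G h A'"
    using s by (metis (no_types, lifting) imageI inv_closed m_closed subsetI)
  then show ?thesis
    using restricted_sumset_mono[OF A'(1)] restricted_sumset_closed[OF A(1)] by blast
qed

end

theorem theorem2p8:
  fixes G :: "('a, 'b) monoid_scheme" and n l h :: nat
  assumes "comm_group G"
    and "finite (carrier G)"
    and "order G = n"
    and "n \<ge> 2"
    and "card (order_le_2_subgroup G) = l"
    and "(real n + real l) / 2 - 1 \<le> real h"
    and "real h \<le> real n - 2"
  shows "C_number G h = h + 1"
proof -
  interpret comm_group G by fact
  note fin = \<open>finite (carrier G)\<close>
  \<comment> \<open>The hypotheses amount to n + l \<le> 2h + 2, which is below 2(h + 2), and to h +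
    2 \<le> n.\<close>
  have "real (n + l) < real (2 * (h + 2))" "real (h + 1) < real n"
    using assms(6,7) by (simp_all add: field_simps)
  then have large: "order G + card (order_le_2_subgroup G) < 2 * (h + 2)" and small: "h + 1 < order G"
    unfolding of_nat_less_iff using assms(3,5) by simp_all
  show ?thesis
    unfolding C_number_def
  proof (rule Max_eqI)
    have "{card A | A. A \<subseteq> carrier G \<and> restricted_sumset G h A \<noteq> carrier G} \<subseteq> card ` Pow (carrier G)"
      by auto
    then show "finite {card A | A. A \<subseteq> carrier G \<and> restricted_sumset G h A \<noteq> carrier G}"
      using finite_subset fin by blast
  next
    fix m assume "m \<in> {card A | A. A \<subseteq> carrier G \<and> restricted_sumset G h A \<noteq> carrier G}"
    then show "m \<le> h + 1"
      \<comment> \<open>By contraposition: a set of at least \<open>h + 2\<close> elements has full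
        sumset.\<close>
      using restricted_sumset_eq_carrier[OF fin _ _ large] by fastforce
  next
    \<comment> \<open>Any set of \<open>h + 1\<close> elements attains the maximum, having at most h
      + 1 < n sums.\<close>
    obtain A where A: "A \<subseteq> carrier G" "finite A" "card A = h + 1"
      using small obtain_subset_with_card_n[of "h + 1" "carrier G"] by (auto simp: order_def)
    then have "restricted_sumset G h A \<noteq> carrier G"
      using card_restricted_sumset_Suc[OF A] small by (auto simp: order_def)
    with A show "h + 1 \<in> {card A | A. A \<subseteq> carrier G \<and> restricted_sumset G h A \<noteq> carrier G}"
      by auto
  qed
qed

end
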